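(* Let $A,B$ be real $2\times 2$ matrices and $a,b$ real $1\times 2$ row vectors, and let $$M^{(1)}=\begin{bmatrix} A & B & I\\ a & b & 0\end{bmatrix}$$ be the $3\times 6$ coefficient tableau (rows 1 and 2 are the constraint rows, row 3 is the cost row). Assume that the cost row is nonzero and that the 2/6-cycle pattern of pivots is selected (pivot on entry $(1,1)$ in iteration 1, then on entry $(2,2)$ in iteration 2), the objective row being scaled so that its first entry is $-1$. Then the coefficient pattern repeats after two iterations, i.e. the tableau $M^{(3)}$ obtained after these two pivots equals $M^{(1)}$ with its columns shifted cyclically two places to the right, if and only if there is a real number $\mu$ such that $$M^{(1)}=\begin{bmatrix} A_{11} & A_{12} & -(A_{11}+1) & -A_{12} & 1 & 0\\ A_{21} & -(A_{11}+1) & -A_{21} & A_{11} & 0 & 1\\ -1 & \mu & -(A_{11}+1)+\mu A_{21} & -A_{12}-\mu A_{11} & 0 & 0\end{bmatrix}$$ and $$-A_{21}A_{12}=1+A_{11}+A_{11}^2 .$$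
   Context: The linear programs considered are: maximize $z=\sum_{j=1}^4 c_jx_j$ subject to two constraints $\sum_{j=1}^4 N_{ij}x_j\le 0$ ($i=1,2$) and $x_j\ge 0$. With slack variables $x_5,x_6$ the constraints become equations with right-hand side $0$, and the objective is written as the row $z-\sum_j c_jx_j=0$. $M^{(1)}$ is the $3\times 6$ matrix of the coefficients of $x_1,\dots,x_6$ in these three rows, with $\begin{bmatrix}A&B\end{bmatrix}=N$ and $\begin{bmatrix}a&b\end{bmatrix}=-c^T$. $M^{(n)}$ denotes the corresponding matrix at the start of iteration $n$; each iteration is a simplex (Gauss-Jordan) pivot on a nonzero entry of a constraint row, applied to all three rows. A column entering the basis has a negative entry in the cost row. Hence, since the first column enters in iteration 1 and positive scaling of the objective row is immaterial, the objective row is normalized so that its first entry is $-1$, i.e. $a=[-1,\mu]$. "$M^{(1)}$ with its columns shifted cyclically two places to the right" is the matrix $\begin{bmatrix} I & A & B\\ 0 & a & b\end{bmatrix}$. *)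

theory Defs
  imports "HOL.Real" "Jordan_Normal_Form.Matrix"
begin

text \<open>Matrices are indexed from 0, so the entry written $(i,j)$ on paper is
  \<^term>\<open>M $$ (i - 1, j - 1)\<close>.\<close>

definition append_cols :: "'a :: zero mat \<Rightarrow> 'a mat \<Rightarrow> 'a mat" (infixr \<open>@\<^sub>c\<close> 65) where
  "A @\<^sub>c B = four_block_mat A B (0\<^sub>m 0 (dim_col A)) (0\<^sub>m 0 (dim_col B))"

definition tableau :: "real mat \<Rightarrow> real mat \<Rightarrow> real mat \<Rightarrow> real mat \<Rightarrow> real mat" where
  "tableau A B a b = (A @\<^sub>c B @\<^sub>c 1\<^sub>m 2) @\<^sub>r (a @\<^sub>c b @\<^sub>c 0\<^sub>m 1 2)"

text \<open>Only meaningful when the pivot entry \<^term>\<open>M $$ (r, c)\<close> is nonzero; otherwise the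
  divisions below silently yield 0.\<close>

definition pivot :: "nat \<Rightarrow> nat \<Rightarrow> real mat \<Rightarrow> real mat" where
  "pivot r c M = mat (dim_row M) (dim_col M) (\<lambda>(i, j).
     if i = r then M $$ (r, j) / M $$ (r, c)
     else M $$ (i, j) - M $$ (i, c) * (M $$ (r, j) / M $$ (r, c)))"

text \<open>Cyclic shift of the columns by \<open>k\<close> places to the right, for \<open>k\<close> at most the number
  of columns (natural-number subtraction).\<close>

definition shift_cols :: "nat \<Rightarrow> 'a mat \<Rightarrow> 'a mat" where
  "shift_cols k M = mat (dim_row M) (dim_col M)
     (\<lambda>(i, j). M $$ (i, (j + (dim_col M - k)) mod dim_col M))"

lemma less_6_cases: "(j::nat) < 6 \<longleftrightarrow> j = 0 \<or> j = 1 \<or> j = 2 \<or> j = 3 \<or> j = 4 \<or> j = 5"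
  by auto

lemma shift_cols_tableau:
  assumes "A \<in> carrier_mat 2 2" "B \<in> carrier_mat 2 2" "a \<in> carrier_mat 1 2" "b \<in> carrier_mat 1 2"
  shows "shift_cols 2 (tableau A B a b)
    = (1\<^sub>m 2 @\<^sub>c A @\<^sub>c B) @\<^sub>r (0\<^sub>m 1 2 @\<^sub>c a @\<^sub>c b)"
  using assms
  by (intro eq_matI)
    (auto simp: shift_cols_def tableau_def append_cols_def append_rows_def less_6_cases)

end

(* Pivoting on (1,1) and (2,2) is left multiplication of the constraint rows by A^-1, so
   M3 has rows [I, A^-1 B, A^-1] and [0, b - a A^-1 B, - a A^-1].  Hence the pattern repeats
   iff B = A^-1, A^3 = I and b = a + a A = - a A^-1.  A real A with A^3 = I has determinant 1
   and is either I, which the cost row rules out (b = 2 a = - a), or has trace -1; the stated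
   form is exactly trace -1, determinant 1 together with B = A^-1 and b = - a A^-1. *)

theory Submission
  imports Defs
begin

lemma less_3_cases: "(i::nat) < 3 \<longleftrightarrow> i = 0 \<or> i = 1 \<or> i = 2"
  by auto

lemma eq_mat_3_6_iff:
  fixes M N :: "'a mat"
  assumes "M \<in> carrier_mat 3 6" "N \<in> carrier_mat 3 6"
  shows "M = N \<longleftrightarrow> (\<forall>i\<in>{0,1,2}. \<forall>j\<in>{0,1,2,3,4,5}. M $$ (i, j) = N $$ (i, j))"
proof -
  have "M = N \<longleftrightarrow> (\<forall>i<3. \<forall>j<6. M $$ (i, j) = N $$ (i, j))"
    using assms by (auto intro: eq_matI)
  then show ?thesis
    by (simp add: less_3_cases less_6_cases all_conj_distrib imp_disjL)
qed

text \<open>The dimensions are fixed independently of the list, so carrier and index facts become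
  simp rules without side conditions on list lengths.\<close>

definition mat_3_6 :: "'a list list \<Rightarrow> 'a mat" where
  "mat_3_6 xss = mat 3 6 (\<lambda>(i, j). xss ! i ! j)"

lemma mat_of_rows_list_3: "mat_of_rows_list 6 [x, y, z] = mat_3_6 [x, y, z]"
  by (simp add: mat_of_rows_list_def mat_3_6_def numeral_3_eq_3)

lemma mat_3_6_carrier [simp]: "mat_3_6 xss \<in> carrier_mat 3 6"
  by (simp add: mat_3_6_def)

lemma mat_3_6_index [simp]: "i < 3 \<Longrightarrow> j < 6 \<Longrightarrow> mat_3_6 xss $$ (i, j) = xss ! i ! j"
  by (simp add: mat_3_6_def)

lemma mat_3_6_dim [simp]: "dim_row (mat_3_6 xss) = 3" "dim_col (mat_3_6 xss) = 6"
  by (simp_all add: mat_3_6_def)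

lemma tableau_eq_mat_3_6:
  assumes "A \<in> carrier_mat 2 2" "B \<in> carrier_mat 2 2" "a \<in> carrier_mat 1 2" "b \<in> carrier_mat 1 2"
  shows "tableau A B a b = mat_3_6
    [[A $$ (0,0), A $$ (0,1), B $$ (0,0), B $$ (0,1), 1, 0],
     [A $$ (1,0), A $$ (1,1), B $$ (1,0), B $$ (1,1), 0, 1],
     [a $$ (0,0), a $$ (0,1), b $$ (0,0), b $$ (0,1), 0, 0]]"
  using assms
  by (intro eq_matI)
    (auto simp: tableau_def append_cols_def append_rows_def less_6_cases less_3_cases)

lemma shift_cols_mat_3_6:
  "shift_cols 2 (mat_3_6 [[p, q, e, f, 1, 0], [r, s, g, h, 0, 1], [l, m, u, v, 0, 0]])
   = mat_3_6 [[1, 0, p, q, e, f], [0, 1, r, s, g, h], [0, 0, l, m, u, v :: real]]"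
  by (subst eq_mat_3_6_iff) (simp_all add: shift_cols_def carrier_matI)

lemma pivot_first:
  fixes p :: real
  assumes "p \<noteq> 0"
  shows "pivot 0 0 (mat_3_6 [[p, q, e, f, 1, 0], [r, s, g, h, 0, 1], [l, m, u, v, 0, 0]])
   = mat_3_6 [[1, q / p, e / p, f / p, 1 / p, 0],
              [0, s - r * (q / p), g - r * (e / p), h - r * (f / p), - (r / p), 1],
              [0, m - l * (q / p), u - l * (e / p), v - l * (f / p), - (l / p), 0]]"
  by (subst eq_mat_3_6_iff) (use assms in \<open>simp_all add: pivot_def carrier_matI\<close>)

text \<open>Here \<open>d\<close> is det A, and the second pivot entry is \<open>d / p\<close>. The
  result is written through the adjugate: \<open>[[s, -q], [-r, p]] / d\<close> is A^-1, and
  \<open>(l * s - m * r, m * p - l * q) / d\<close> is the row a A^-1.\<close>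

lemma pivot_twice:
  fixes p q r s :: real
  assumes p: "p \<noteq> 0" and nz: "s - r * (q / p) \<noteq> 0"
  defines "d \<equiv> p * s - q * r"
  shows "d \<noteq> 0"
    and "pivot 1 1 (pivot 0 0
      (mat_3_6 [[p, q, e, f, 1, 0], [r, s, g, h, 0, 1], [l, m, u, v, 0, 0]]))
   = mat_3_6
      [[1, 0, (s * e - q * g) / d, (s * f - q * h) / d, s / d, - q / d],
       [0, 1, (p * g - r * e) / d, (p * h - r * f) / d, - r / d, p / d],
       [0, 0, u - ((l * s - m * r) * e + (m * p - l * q) * g) / d,
              v - ((l * s - m * r) * f + (m * p - l * q) * h) / d,
              - (l * s - m * r) / d, - (m * p - l * q) / d]]" (is ?twice)
proof -
  have s': "s - r * (q / p) = d / p"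
    using p by (simp add: d_def field_simps)
  then show d: "d \<noteq> 0"
    using nz by auto
  \<comment> \<open>Eliminating \<open>s\<close> in favour of \<open>d\<close> leaves rational
    identities whose only denominators are \<open>p\<close> and \<open>d\<close>, both known to be
    nonzero.\<close>
  have s: "s = (d + q * r) / p"
    using p by (simp add: d_def)
  show ?twice
    unfolding pivot_first[OF p] s'
    using p d
    by (subst eq_mat_3_6_iff, simp_all add: pivot_def carrier_matI s divide_simps)
      (simp_all add: algebra_simps)
qed

text \<open>The left side compares columns 3 to 6 of the twice pivoted tableau, with
  \<open>l = -1\<close>, to those of the shifted one; the first two columns agree
  automatically.\<close>

lemma two_cycle_equations_iff:
  fixes p q r s e f g h m u v :: real
  defines "d \<equiv> p * s - q * r"
  assumes d: "d \<noteq> 0"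
  shows "(s * e - q * g) / d = p \<and> (s * f - q * h) / d = q \<and> s / d = e \<and> - q / d = f \<and>
      (p * g - r * e) / d = r \<and> (p * h - r * f) / d = s \<and> - r / d = g \<and> p / d = h \<and>
      u - ((- s - m * r) * e + (m * p + q) * g) / d = -1 \<and>
      v - ((- s - m * r) * f + (m * p + q) * h) / d = m \<and>
      - (- s - m * r) / d = u \<and> - (m * p + q) / d = v
    \<longleftrightarrow> s = - (p + 1) \<and> e = - (p + 1) \<and> f = - q \<and> g = - r \<and> h = p \<and>
      u = - (p + 1) + m * r \<and> v = - q - m * p \<and> - r * q = 1 + p + p\<^sup>2"
    (is "?L \<longleftrightarrow> ?R")
proof
  assume L: ?L
  \<comment> \<open>The last two columns of the constraint rows say that B = A^-1.\<close>
  have inv: "s = d * e" "- q = d * f" "- r = d * g" "p = d * h"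
    using L d by (auto simp: field_simps)
  \<comment> \<open>Since A^-1 B = A, this yields B^2 = A.\<close>
  have eqs: "e * e + f * g = p" "e * f + f * h = q" "g * e + h * g = r" "g * f + h * h = s"
  proof -
    have "s * e - q * g = d * p" "s * f - q * h = d * q"
      "p * g - r * e = d * r" "p * h - r * f = d * s"
      using L d by (auto simp: field_simps)
    moreover have "d * e = s" "d * f = - q" "d * g = - r" "d * h = p"
      using inv by simp_all
    ultimately have "d * (e * e + f * g) = d * p" "d * (e * f + f * h) = d * q"
      "d * (g * e + h * g) = d * r" "d * (g * f + h * h) = d * s"
      by (simp_all add: distrib_left flip: mult.assoc)
    then show "e * e + f * g = p" "e * f + f * h = q" "g * e + h * g = r" "g * f + h * h = s"
      using d by simp_all
  qed
  have d_B: "d * (e * h - f * g) = 1"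
  proof -
    have "d * (d * (e * h - f * g)) = (d * e) * (d * h) - (d * f) * (d * g)"
      by (simp add: algebra_simps)
    also have "\<dots> = d"
      unfolding inv[symmetric] by (simp add: d_def algebra_simps)
    finally have "d * (d * (e * h - f * g)) = d" .
    then show ?thesis using d by simp
  qed
  \<comment> \<open>Taking determinants in B^2 = A. Together with \<open>d_B\<close> this makes det
    B a real cube root of 1, hence 1.\<close>
  have "(e * h - f * g)\<^sup>2 = d"
    unfolding d_def eqs[symmetric] by (simp add: power2_eq_square algebra_simps)
  with d_B have "(e * h - f * g) ^ 3 = 1 ^ 3"
    by (simp add: power3_eq_cube power2_eq_square)
  then have "e * h - f * g = 1"
    by (metis odd_numeral odd_real_root_power_cancel)
  with d_B have d1: "d = 1" by simp
  note B = inv[unfolded d1, simplified]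
  have uv: "- s - m * r = - u" "m * p + q = - v"
    using L d1 by auto
  have "u - ((- s - m * r) * e + (m * p + q) * g) = -1"
    "v - ((- s - m * r) * f + (m * p + q) * h) = m"
    using L unfolding d1 div_by_1 by blast+
  \<comment> \<open>The cost row in the form b + b B = a.\<close>
  then have cost: "u + u * e + v * g = -1" "v + u * f + v * h = m"
    unfolding uv by simp_all
  have det: "p * s - q * r = 1" using d1 d_def by simp
  have "p + s = -1"
  proof (rule ccontr)
    assume ne: "p + s \<noteq> -1"
    have "e = s" "f = - q" "g = - r" "h = p" using B by simp_all
    \<comment> \<open>With B equal to the adjugate of A, the equation B^2 = A and det A = 1 combine
      to (tr A + 1)(A - I) = 0, entry by entry.\<close>
    with eqs have "s * s + q * r = p" "q * (p + s + 1) = 0" "r * (p + s + 1) = 0" "p * p + q * r = s"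
      by (simp_all add: algebra_simps)
    moreover from this det have "(p - 1) * (p + s + 1) = 0" "(s - 1) * (p + s + 1) = 0"
      by (simp_all add: algebra_simps)
    ultimately have "q * (p + s + 1) = 0" "r * (p + s + 1) = 0"
      "(p - 1) * (p + s + 1) = 0" "(s - 1) * (p + s + 1) = 0"
      by simp_all
    with ne have "q = 0" "r = 0" "p = 1" "s = 1" by (auto simp: add_eq_0_iff)
    \<comment> \<open>For A = B = I one gets \<open>u = 1\<close>, whereas \<open>cost(1)\<close>
      reads \<open>2 * u = -1\<close>.\<close>
    with cost(1) B uv(1) show False by simp
  qed
  then have s: "s = - (p + 1)" by simp
  have "- r * q = 1 + p + p\<^sup>2"
    using det unfolding s by (simp add: algebra_simps power2_eq_square)
  moreover have "e = s" "f = - q" "g = - r" "h = p" "u = s + m * r" "v = - q - m * p"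
    using B uv by simp_all
  ultimately show ?R
    using s by simp
next
  assume R: ?R
  then have sub: "s = - (p + 1)" "e = - (p + 1)" "f = - q" "g = - r" "h = p"
      "u = - (p + 1) + m * r" "v = - q - m * p"
    and qr: "q * r = - 1 - p - p * p"
    by (simp_all add: power2_eq_square algebra_simps)
  have d1: "d = 1"
    unfolding d_def sub using qr by (simp add: algebra_simps)
  \<comment> \<open>Expanding the cost equation for \<open>v\<close> produces the product of
    \<open>m\<close>, \<open>q\<close> and \<open>r\<close>, which \<open>qr\<close> alone does not
    rewrite in normalized form.\<close>
  have "m * (q * r) = - m - m * p - m * (p * p)"
    unfolding qr by (simp add: algebra_simps)
  with qr show ?L
    unfolding d1 sub by (simp add: algebra_simps)
qed

theorem proposition1:
  fixes A B a b M1 M2 M3 :: "real mat"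
  assumes "A \<in> carrier_mat 2 2" and "B \<in> carrier_mat 2 2"
    and "a \<in> carrier_mat 1 2" and "b \<in> carrier_mat 1 2"
    and "M1 = tableau A B a b"
    and "row M1 2 \<noteq> 0\<^sub>v 6"
    and "M1 $$ (2, 0) = -1"
    and "M1 $$ (0, 0) \<noteq> 0" and "M2 = pivot 0 0 M1"
    and "M2 $$ (1, 1) \<noteq> 0" and "M3 = pivot 1 1 M2"
  shows "M3 = shift_cols 2 M1 \<longleftrightarrow>
    (\<exists>\<mu>::real.
      M1 = mat_of_rows_list 6
        [[A $$ (0,0), A $$ (0,1), - (A $$ (0,0) + 1), - A $$ (0,1), 1, 0],
         [A $$ (1,0), - (A $$ (0,0) + 1), - A $$ (1,0), A $$ (0,0), 0, 1],
         [-1, \<mu>, - (A $$ (0,0) + 1) + \<mu> * A $$ (1,0), - A $$ (0,1) - \<mu> * A $$ (0,0), 0, 0]]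
      \<and> - A $$ (1,0) * A $$ (0,1) = 1 + A $$ (0,0) + (A $$ (0,0))\<^sup>2)"
proof -
  define p q r s where A_defs: "p = A $$ (0,0)" "q = A $$ (0,1)" "r = A $$ (1,0)" "s = A $$ (1,1)"
  define e f g h where B_defs: "e = B $$ (0,0)" "f = B $$ (0,1)" "g = B $$ (1,0)" "h = B $$ (1,1)"
  define m u v where cost_defs: "m = a $$ (0,1)" "u = b $$ (0,0)" "v = b $$ (0,1)"
  note defs = A_defs B_defs cost_defs
  have M1': "M1 = mat_3_6 [[p, q, e, f, 1, 0], [r, s, g, h, 0, 1], [a $$ (0,0), m, u, v, 0, 0]]"
    using assms(1-5) by (simp add: tableau_eq_mat_3_6 defs)
  with assms(7) have M1: "M1 = mat_3_6 [[p, q, e, f, 1, 0], [r, s, g, h, 0, 1], [-1, m, u, v, 0, 0]]"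
    by simp
  have p: "p \<noteq> 0" using assms(8) M1 by simp
  have piv: "s - r * (q / p) \<noteq> 0"
    using assms(9,10) M1 p by (simp add: pivot_first)
  note M3 = pivot_twice(2)[OF p piv, of e f g h "-1" m u v, folded M1 assms(9,11)]
  have "M3 = shift_cols 2 M1 \<longleftrightarrow>
      s = - (p + 1) \<and> e = - (p + 1) \<and> f = - q \<and> g = - r \<and> h = p \<and>
      u = - (p + 1) + m * r \<and> v = - q - m * p \<and> - r * q = 1 + p + p\<^sup>2"
    \<comment> \<open>The closed form is turned back into the twelve equations, so that only an
      entrywise comparison remains.\<close>
    unfolding two_cycle_equations_iff[OF pivot_twice(1)[OF p piv], symmetric]
    unfolding M3 unfolding M1 shift_cols_mat_3_6
    by (subst eq_mat_3_6_iff) auto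
  \<comment> \<open>The second cost entry forces the witness \<open>\<mu> = m\<close>.\<close>
  also have "\<dots> \<longleftrightarrow> (\<exists>\<mu>. M1 = mat_3_6
        [[p, q, - (p + 1), - q, 1, 0],
         [r, - (p + 1), - r, p, 0, 1],
         [-1, \<mu>, - (p + 1) + \<mu> * r, - q - \<mu> * p, 0, 0]]
      \<and> - r * q = 1 + p + p\<^sup>2)"
    unfolding M1 by (subst eq_mat_3_6_iff) auto
  finally show ?thesis
    by (simp only: A_defs mat_of_rows_list_3)
qed

end
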